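(* Let $p$ be an odd prime and let $g,n$ be positive integers with $g\mid p(p-1)$. If $$n\le p-1-\left\lfloor \frac{g}{2}\right\rfloor,\qquad n=ag+r,\qquad 0\le r<g,$$ with $a,r$ integers, then $$G(g,n)\le \frac{p(p-1)}{g}-\left\lceil \frac{\frac{p(p-1)}{g}+\frac{g a(a-1)}2+ra}{n}\right\rceil.$$
   Context: A finite set $\mathcal{G}\subset\mathbb{Z}$ is a $g$-Golomb ruler if for every positive integer $d$ the number of pairs $(a,c)\in \mathcal{G}^2$ with $c-a=d$ is at most $g$. $G(g,n)$ denotes the minimum possible diameter (largest element minus smallest element) of a $g$-Golomb ruler with exactly $n$ elements (marks). *)

theory Defs
  imports Complex_Main "HOL-Number_Theory.Number_Theory"
begin

definition golomb_ruler :: "nat \<Rightarrow> int set \<Rightarrow> bool" where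
  "golomb_ruler g A \<longleftrightarrow>
     finite A \<and> (\<forall>d>0. card {(a, c). a \<in> A \<and> c \<in> A \<and> c - a = d} \<le> g)"

definition ruler_diameter :: "int set \<Rightarrow> int" where
  "ruler_diameter A = Max A - Min A"

text \<open>The diameter is only meaningful for nonempty rulers, so \<open>G g n\<close> is intended for
  \<open>n \<ge> 1\<close> (and \<open>g \<ge> 1\<close>); the minimum is then attained, see \<open>G_attained\<close>.\<close>

definition G :: "nat \<Rightarrow> nat \<Rightarrow> nat" where
  "G g n = (LEAST D. \<exists>A. golomb_ruler g A \<and> card A = n \<and> ruler_diameter A = int D)"

lemma golomb_ruler_powers:
  assumes "g \<ge> 1"
  shows "golomb_ruler g ((\<lambda>i. 2 ^ i) ` {..<n::nat})"
proof -
  let ?A = "(\<lambda>i. 2 ^ i :: int) ` {..<n}"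
  have top: False
    if lt: "k < m" and ij: "j < m" and eq: "2 ^ k - 2 ^ i = (2 ^ m - 2 ^ j :: int)"
    for i j k m :: nat
  proof -
    obtain m' where m: "m = Suc m'" using lt by (cases m) auto
    have "(2::int) ^ k \<le> 2 ^ m'" "(2::int) ^ j \<le> 2 ^ m'"
      using lt ij m by (auto intro: power_increasing)
    moreover have "(2::int) ^ i > 0" by simp
    ultimately show False using eq unfolding m power_Suc by linarith
  qed
  have uniq: "x = y"
    if "d > 0" "x \<in> {(a, c). a \<in> ?A \<and> c \<in> ?A \<and> c - a = d}"
       "y \<in> {(a, c). a \<in> ?A \<and> c \<in> ?A \<and> c - a = d}" for d x y
  proof -
    from that obtain i k j m where x: "x = (2 ^ i, 2 ^ k)" and y: "y = (2 ^ j, 2 ^ m)"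
      and dx: "2 ^ k - 2 ^ i = d" and dy: "2 ^ m - 2 ^ j = d" by auto
    have "(2::int) ^ i < 2 ^ k" "(2::int) ^ j < 2 ^ m" using dx dy \<open>d > 0\<close> by linarith+
    then have "i < k" "j < m" by auto
    then have "k = m" using top[of k m j i] top[of m k i j] dx dy by (metis nat_neq_iff)
    then show ?thesis using x y dx dy by auto
  qed
  have "card {(a, c). a \<in> ?A \<and> c \<in> ?A \<and> c - a = d} \<le> g" if d: "d > 0" for d
  proof (cases "{(a, c). a \<in> ?A \<and> c \<in> ?A \<and> c - a = d} = {}")
    case False
    then obtain x where "{(a, c). a \<in> ?A \<and> c \<in> ?A \<and> c - a = d} = {x}"
      using uniq[OF d] by blast
    then show ?thesis using assms by simp
  qed (simp only: card.empty)
  then show ?thesis unfolding golomb_ruler_def by simp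
qed

lemma G_attained:
  assumes "g \<ge> 1" "n \<ge> 1"
  shows "\<exists>A. golomb_ruler g A \<and> card A = n \<and> ruler_diameter A = int (G g n)"
proof -
  let ?A = "(\<lambda>i. 2 ^ i :: int) ` {..<n}"
  have "card ?A = n" by (simp add: card_image inj_on_def)
  moreover have "ruler_diameter ?A = int (nat (ruler_diameter ?A))"
  proof -
    have "?A \<noteq> {}" "finite ?A" using assms by (auto simp: lessThan_empty_iff)
    then have "Min ?A \<le> Max ?A" by (meson Max_ge Min_in)
    then show ?thesis unfolding ruler_diameter_def by simp
  qed
  ultimately have "\<exists>D A. golomb_ruler g A \<and> card A = n \<and> ruler_diameter A = int D"
    using golomb_ruler_powers[OF assms(1)] by blast
  then show ?thesis unfolding G_def by (rule LeastI_ex)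
qed

end

theory Submission
  imports Defs
begin

text \<open>Ruzsa's set is a Sidon set of \<open>p - 1\<close> elements modulo \<open>p * (p - 1) = g * m\<close>. Every difference
  modulo \<open>m\<close> has \<open>g\<close> lifts, so reducing the set modulo \<open>m\<close> loses at most \<open>g div 2\<close> elements to
  collisions and leaves each nonzero difference represented at most \<open>g\<close> times. Pick \<open>n\<close> of the
  remaining residues. Their \<open>n\<close> cyclic gaps sum to \<open>m\<close> and take each value at most \<open>g\<close> times, so
  with \<open>L\<close> the largest gap the numbers \<open>L - gap\<close> sum to at least
  \<open>g * (0 + 1 + \<dots> + (a - 1)) + r * a\<close>. Cutting the circle open at the largest gap yields a ruler of
  diameter at most \<open>m - L\<close>.\<close>

section \<open>Sums of integers with bounded multiplicities\<close>

text \<open>Induction on \<open>k\<close> for the sum of the truncations \<open>min (f x) k\<close>.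
  Raising \<open>k\<close> by one adds 1 for each \<open>x\<close> with \<open>f x > k\<close>, and
  at most \<open>g * (k + 1)\<close> elements have a value in \<open>{0..k}\<close>. Doubling keeps
  the triangular number free of division.\<close>

lemma sum_ge_of_bounded_fibres:
  fixes f :: "'a \<Rightarrow> int"
  assumes "finite S" "\<And>x. x \<in> S \<Longrightarrow> 0 \<le> f x"
    and fibre: "\<And>c. card {x \<in> S. f x = c} \<le> g"
  shows "2 * int k * int (card S) \<le> 2 * (\<Sum>x\<in>S. f x) + int g * int k * (int k + 1)"
proof -
  have "2 * int k * int (card S) \<le> 2 * (\<Sum>x\<in>S. min (f x) (int k)) + int g * int k * (int k + 1)"
  proof (induction k)
    case 0
    then show ?case using assms(2) by (simp add: sum_nonneg)
  next
    case (Suc k)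
    have "{x \<in> S. f x \<le> int k} \<subseteq> (\<Union>c\<in>{0..int k}. {x \<in> S. f x = c})"
      using assms(2) by auto
    then have "card {x \<in> S. f x \<le> int k} \<le> card (\<Union>c\<in>{0..int k}. {x \<in> S. f x = c})"
      using \<open>finite S\<close> by (intro card_mono) auto
    also have "\<dots> \<le> (\<Sum>c\<in>{0..int k}. card {x \<in> S. f x = c})"
      by (intro card_UN_le) auto
    also have "\<dots> \<le> (\<Sum>c\<in>{0..int k}. g)"
      using fibre by (intro sum_mono) auto
    finally have low: "int (card {x \<in> S. f x \<le> int k}) \<le> int g * (int k + 1)"
      by (simp add: algebra_simps nat_add_distrib flip: of_nat_mult of_nat_add)
    have "(\<Sum>x\<in>S. min (f x) (int (Suc k)))
        = (\<Sum>x\<in>S. min (f x) (int k) + 1 - (if f x \<le> int k then 1 else 0))"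
      by (intro sum.cong) auto
    also have "\<dots> = (\<Sum>x\<in>S. min (f x) (int k)) + int (card S) - int (card {x \<in> S. f x \<le> int k})"
      using \<open>finite S\<close>
      by (simp add: sum.distrib sum_subtractf sum.If_cases Int_def)
    finally show ?case using low Suc.IH by (simp add: algebra_simps)
  qed
  also have "(\<Sum>x\<in>S. min (f x) (int k)) \<le> (\<Sum>x\<in>S. f x)"
    by (intro sum_mono) auto
  finally show ?thesis by simp
qed

section \<open>Gaps of a set of residues\<close>

text \<open>The distance from \<open>x\<close> to the next element of \<open>B\<close> around the
  circle. That element may be \<open>x\<close> itself after a full turn, so a singleton has gap
  \<open>m\<close>.\<close>

definition cyclic_gap :: "int \<Rightarrow> int set \<Rightarrow> int \<Rightarrow> nat" where
  "cyclic_gap m B x = (LEAST d. 0 < d \<and> (x + int d) mod m \<in> B)"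

lemma cyclic_gap:
  assumes "0 < m" "B \<subseteq> {0..<m}" "x \<in> B"
  shows "0 < cyclic_gap m B x" "(x + int (cyclic_gap m B x)) mod m \<in> B"
    and "cyclic_gap m B x \<le> nat m"
proof -
  \<comment> \<open>A full turn returns to \<open>x\<close>, so the \<open>LEAST\<close> is taken
    over a nonempty set and is at most \<open>nat m\<close>.\<close>
  have *: "0 < nat m \<and> (x + int (nat m)) mod m \<in> B"
    using assms by (auto simp: subset_iff)
  show "0 < cyclic_gap m B x" "(x + int (cyclic_gap m B x)) mod m \<in> B"
    using LeastI[where P = "\<lambda>d. 0 < d \<and> (x + int d) mod m \<in> B", OF *]
    unfolding cyclic_gap_def by auto
  show "cyclic_gap m B x \<le> nat m"
    unfolding cyclic_gap_def using * by (rule Least_le)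
qed

lemma cyclic_gap_le:
  assumes "0 < d" "(x + int d) mod m \<in> B"
  shows "cyclic_gap m B x \<le> d"
  unfolding cyclic_gap_def using assms by (intro Least_le) auto

text \<open>The arcs that start at the elements of \<open>B\<close>, each as long as the gap there,
  cover the circle. A residue \<open>y\<close> lies in the arc of the first \<open>x\<close> in
  \<open>B\<close> met walking backwards from \<open>y\<close>: if the gap at \<open>x\<close> ended
  at or before \<open>y\<close>, its end would have been met sooner.\<close>

lemma sum_cyclic_gap_ge:
  assumes "0 < m" "B \<subseteq> {0..<m}" "B \<noteq> {}"
  shows "m \<le> (\<Sum>x\<in>B. int (cyclic_gap m B x))"
proof -
  have "finite B" using assms finite_subset by blast
  let ?arc = "\<lambda>x. (\<lambda>k. (x + int k) mod m) ` {..<cyclic_gap m B x}"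
  have "{0..<m} \<subseteq> (\<Union>x\<in>B. ?arc x)"
  proof
    fix y assume y: "y \<in> {0..<m}"
    obtain b where b: "b \<in> B" using assms by auto
    define Q where "Q k \<longleftrightarrow> (y - int k) mod m \<in> B" for k
    have "Q (nat ((y - b) mod m))"
      using assms b by (auto simp: Q_def mod_diff_right_eq subset_iff)
    then have Qk: "Q (LEAST k. Q k)" by (rule LeastI)
    define k where "k = (LEAST k. Q k)"
    define x where "x = (y - int k) mod m"
    have x: "x \<in> B" using Qk by (simp add: x_def k_def Q_def)
    have "(x + int k) mod m = y" using y by (simp add: x_def mod_add_left_eq)
    moreover have "k < cyclic_gap m B x"
    proof (rule ccontr)
      assume neg: "\<not> ?thesis"
      let ?d = "cyclic_gap m B x"
      have "(x + int ?d) mod m = (y - int (k - ?d)) mod m"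
        using neg by (simp add: x_def mod_add_left_eq of_nat_diff algebra_simps)
      then have "Q (k - ?d)" using cyclic_gap(2)[OF assms(1,2) x] by (simp add: Q_def)
      then have "k \<le> k - ?d" unfolding k_def by (rule Least_le)
      then show False using neg cyclic_gap(1)[OF assms(1,2) x] by simp
    qed
    ultimately show "y \<in> (\<Union>x\<in>B. ?arc x)" using x by force
  qed
  then have "card {0..<m} \<le> card (\<Union>x\<in>B. ?arc x)"
    using \<open>finite B\<close> by (intro card_mono) auto
  also have "\<dots> \<le> (\<Sum>x\<in>B. card (?arc x))" using \<open>finite B\<close> by (rule card_UN_le)
  also have "\<dots> \<le> (\<Sum>x\<in>B. cyclic_gap m B x)"
    by (intro sum_mono) (metis card_image_le card_lessThan finite_lessThan)
  finally show ?thesis by (simp add: nat_le_iff)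
qed

section \<open>Modular rulers and cutting the circle\<close>

definition modular_golomb :: "nat \<Rightarrow> int \<Rightarrow> int set \<Rightarrow> bool" where
  "modular_golomb g m B \<longleftrightarrow> B \<subseteq> {0..<m} \<and>
     (\<forall>d. 0 < d \<and> d < m \<longrightarrow> card {(u, w). u \<in> B \<and> w \<in> B \<and> (w - u) mod m = d} \<le> g)"

text \<open>For \<open>c < m\<close> the map from \<open>x\<close> to \<open>(x, x + c)\<close>
  sends the fibre injectively to pairs of difference \<open>c\<close>. The value
  \<open>c = m\<close> is not controlled by \<open>modular_golomb\<close>, but a gap
  \<open>m\<close> leaves no room for a second element, and \<open>g\<close> is positive.\<close>

lemma card_cyclic_gap_fibre:
  assumes "0 < m" "0 < g" and B: "modular_golomb g m B"
  shows "card {x \<in> B. int (cyclic_gap m B x) = c} \<le> g"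
proof -
  have sub: "B \<subseteq> {0..<m}" using B by (simp add: modular_golomb_def)
  then have fin: "finite B" using finite_subset by blast
  let ?F = "{x \<in> B. int (cyclic_gap m B x) = c}"
  consider "?F = {}" | "0 < c" "c < m" | "c = m" "?F \<noteq> {}"
    using cyclic_gap(1,3)[OF assms(1) sub] by fastforce
  then show ?thesis
  proof cases
    case 2
    let ?P = "{(u, w). u \<in> B \<and> w \<in> B \<and> (w - u) mod m = c}"
    have "card ?F = card ((\<lambda>x. (x, (x + c) mod m)) ` ?F)"
      by (rule card_image[symmetric]) (auto simp: inj_on_def)
    also have "\<dots> \<le> card ?P"
    proof (rule card_mono)
      show "finite ?P" by (rule finite_subset[of _ "B \<times> B"]) (use fin in auto)
      show "(\<lambda>x. (x, (x + c) mod m)) ` ?F \<subseteq> ?P"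
        using cyclic_gap(2)[OF assms(1) sub] 2 by (auto simp: mod_diff_left_eq)
    qed
    also have "\<dots> \<le> g" using B 2 by (auto simp: modular_golomb_def)
    finally show ?thesis .
  next
    case 3
    have "x = y" if "x \<in> ?F" "y \<in> ?F" for x y
    proof (rule ccontr)
      assume ne: "x \<noteq> y"
      have xy: "x \<in> {0..<m}" "y \<in> {0..<m}" using that sub by auto
      let ?d = "nat ((y - x) mod m)"
      have "(y - x) mod m \<noteq> 0"
        using xy ne by (metis atLeastLessThan_iff mod_eq_dvd_iff mod_pos_pos_trivial dvd_eq_mod_eq_0)
      moreover have "0 \<le> (y - x) mod m" "(y - x) mod m < m" using \<open>0 < m\<close> by auto
      ultimately have d: "0 < (y - x) mod m" "(y - x) mod m < m" by linarith+
      have "(x + int ?d) mod m = y" using xy d by (simp add: mod_add_right_eq)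
      then have "cyclic_gap m B x \<le> ?d" using that d by (intro cyclic_gap_le) auto
      then show False using that d 3 by auto
    qed
    then have "card ?F \<le> 1" using fin by (auto simp: card_le_Suc0_iff_eq)
    then show ?thesis using \<open>0 < g\<close> by linarith
  qed (simp only: card.empty)
qed

text \<open>Unroll the cyclic set starting just after one of its gaps, so that this gap is lost.\<close>

lemma golomb_ruler_cut:
  assumes "0 < m" and B: "modular_golomb g m B" and x: "x \<in> B"
  shows "\<exists>A D. golomb_ruler g A \<and> card A = card B \<and> ruler_diameter A = int D
           \<and> int D \<le> m - int (cyclic_gap m B x)"
proof -
  have sub: "B \<subseteq> {0..<m}" using B by (simp add: modular_golomb_def)
  then have fin: "finite B" using finite_subset by blast
  define L where "L = cyclic_gap m B x"
  define s where "s = (x + int L) mod m"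
  have s: "s \<in> B" using cyclic_gap(2)[OF assms(1) sub x] by (simp add: s_def L_def)
  \<comment> \<open>The rotation that moves \<open>s\<close>, the element ending the gap after
    \<open>x\<close>, to 0.\<close>
  define h where "h b = (b - s) mod m" for b
  define A where "A = h ` B"
  have unshift: "(h b + s) mod m = b" if "b \<in> B" for b
    using that sub by (auto simp: h_def mod_add_left_eq subset_iff)
  then have inj: "inj_on h B" by (metis inj_onI)
  have rng: "0 \<le> h b" "h b < m" for b using \<open>0 < m\<close> by (auto simp: h_def)
  \<comment> \<open>A larger \<open>h b\<close> would place \<open>b\<close> strictly inside the gap
    after \<open>x\<close>, at distance \<open>L + h b - m < L\<close>.\<close>
  have le: "h b \<le> m - int L" if b: "b \<in> B" for b
  proof (rule ccontr)
    assume neg: "\<not> ?thesis"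
    let ?d = "nat (int L + h b - m)"
    have "(x + int ?d) mod m = (h b + (x + int L)) mod m"
      using neg by (simp add: algebra_simps)
    also have "\<dots> = b" using unshift[OF b] by (simp add: s_def mod_add_right_eq)
    finally have "L \<le> ?d" unfolding L_def using b neg
      by (intro cyclic_gap_le) (auto simp: L_def)
    then show False using rng[of b] neg by linarith
  qed
  have "h s = 0" by (simp add: h_def)
  then have A0: "0 \<in> A" using s by (force simp: A_def)
  have finA: "finite A" using fin by (simp add: A_def)
  have "golomb_ruler g A"
    unfolding golomb_ruler_def
  proof (intro conjI allI impI finA)
    fix d :: int assume "d > 0"
    let ?P = "{(a, c). a \<in> A \<and> c \<in> A \<and> c - a = d}"
    show "card ?P \<le> g"
    proof (cases "d < m")
      case True
      let ?Q = "{(u, w). u \<in> B \<and> w \<in> B \<and> (w - u) mod m = d}"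
      have finQ: "finite ?Q" by (rule finite_subset[of _ "B \<times> B"]) (use fin in auto)
      have "?P \<subseteq> map_prod h h ` ?Q"
      proof clarify
        fix a c assume "a \<in> A" "c \<in> A" and d: "d = c - a"
        then obtain u w where uw: "u \<in> B" "w \<in> B" "a = h u" "c = h w" by (auto simp: A_def)
        have "(w - u) mod m = (h w - h u) mod m" by (simp add: h_def mod_diff_eq)
        also have "\<dots> = c - a" using True \<open>d > 0\<close> d uw by simp
        finally show "(a, c) \<in> map_prod h h ` {(u, w). u \<in> B \<and> w \<in> B \<and> (w - u) mod m = c - a}"
          using uw by force
      qed
      then have "card ?P \<le> card ?Q" by (rule surj_card_le[OF finQ])
      also have "\<dots> \<le> g" using B True \<open>d > 0\<close> by (auto simp: modular_golomb_def)
      finally show ?thesis .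
    next
      case False
      have "c - a < m" if "a \<in> A" "c \<in> A" for a c
        using that rng by (auto simp: A_def) (smt (verit) rng)
      then have "?P = {}" using False by force
      then show ?thesis by (simp only: card.empty)
    qed
  qed
  moreover have "card A = card B" using inj by (simp add: A_def card_image)
  moreover have "0 \<le> ruler_diameter A"
    using A0 finA by (auto simp: ruler_diameter_def intro: order_trans[OF Min_le Max_ge])
  moreover have "ruler_diameter A \<le> m - int L"
  proof -
    have "Max A \<le> m - int L" using A0 finA le by (subst Max_le_iff) (auto simp: A_def)
    moreover have "0 \<le> Min A" using A0 finA rng by (subst Min_ge_iff) (auto simp: A_def)
    ultimately show ?thesis by (simp add: ruler_diameter_def)
  qed
  ultimately show ?thesis unfolding L_def by (metis nonneg_int_cases)
qed

text \<open>\<open>L\<close> is the largest gap. Its lower bound is stated multiplied by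
  \<open>2 * card B\<close>, which keeps the argument in the integers until the final
  ceiling.\<close>

lemma G_le_of_modular_golomb:
  assumes "0 < m" "0 < g" and B: "modular_golomb g m B" and "B \<noteq> {}"
    and card: "card B = a * g + r"
  shows "\<exists>L. int (G g (card B)) \<le> m - L
    \<and> 2 * m + int g * int a * (int a - 1) + 2 * int r * int a \<le> 2 * int (card B) * L"
proof -
  have sub: "B \<subseteq> {0..<m}" using B by (simp add: modular_golomb_def)
  then have fin: "finite B" using finite_subset by blast
  let ?gap = "\<lambda>x. int (cyclic_gap m B x)"
  define L where "L = Max (?gap ` B)"
  have "L \<in> ?gap ` B" unfolding L_def using fin \<open>B \<noteq> {}\<close> by (intro Max_in) auto
  then obtain x where x: "x \<in> B" "L = ?gap x" by auto
  obtain A D where "golomb_ruler g A" "card A = card B" "ruler_diameter A = int D" "int D \<le> m - L"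
    using golomb_ruler_cut[OF \<open>0 < m\<close> B x(1)] x(2) by auto
  then have "G g (card B) \<le> D" unfolding G_def by (intro Least_le) auto
  with \<open>int D \<le> m - L\<close> have G: "int (G g (card B)) \<le> m - L" by linarith
  have "card {x \<in> B. L - ?gap x = c} \<le> g" for c
  proof -
    have "{x \<in> B. L - ?gap x = c} = {x \<in> B. ?gap x = L - c}" by auto
    then show ?thesis using card_cyclic_gap_fibre[OF \<open>0 < m\<close> \<open>0 < g\<close> B] by simp
  qed
  \<comment> \<open>The truncation level \<open>k = a\<close> is the one that turns
    \<open>a * (a * g + r) - g * a * (a + 1) / 2\<close> into
    \<open>g * a * (a - 1) / 2 + r * a\<close>.\<close>
  then have "2 * int a * int (card B) \<le> 2 * (\<Sum>x\<in>B. L - ?gap x) + int g * int a * (int a + 1)"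
    using fin by (intro sum_ge_of_bounded_fibres) (auto simp: L_def)
  moreover have "(\<Sum>x\<in>B. L - ?gap x) \<le> int (card B) * L - m"
    using sum_cyclic_gap_ge[OF \<open>0 < m\<close> sub \<open>B \<noteq> {}\<close>] by (simp add: sum_subtractf)
  ultimately have "2 * int a * int (card B) \<le> 2 * (int (card B) * L - m) + int g * int a * (int a + 1)"
    by (meson add_right_mono mult_left_mono order_trans zero_le_numeral)
  then have "2 * m + int g * int a * (int a - 1) + 2 * int r * int a \<le> 2 * int (card B) * L"
    unfolding card by (simp add: algebra_simps)
  with G show ?thesis by blast
qed

section \<open>Sidon families, their reduction modulo \<open>m\<close>, and Ruzsa's set\<close>

text \<open>A Sidon set modulo \<open>v\<close>, given with an indexing: elements that collide
  modulo a divisor of \<open>v\<close> keep distinct names, and the order of indices can select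
  representatives.\<close>

definition sidon_family :: "int \<Rightarrow> nat set \<Rightarrow> (nat \<Rightarrow> int) \<Rightarrow> bool" where
  "sidon_family v I x \<longleftrightarrow> (\<forall>i\<in>I. \<forall>j\<in>I. \<forall>k\<in>I. \<forall>l\<in>I.
     i \<noteq> j \<longrightarrow> k \<noteq> l \<longrightarrow> [x i - x j = x k - x l] (mod v) \<longrightarrow> i = k \<and> j = l)"

text \<open>A residue class modulo \<open>m\<close> splits into \<open>g\<close> residue classes modulo \<open>g * m\<close>.\<close>

lemma sidon_family_card_pairs:
  assumes "0 < m" "0 < g" and S: "sidon_family (int g * m) I x"
    and P: "\<And>i j. (i, j) \<in> P \<Longrightarrow> i \<in> I \<and> j \<in> I \<and> i \<noteq> j \<and> (x i - x j) mod m = d"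
  shows "card P \<le> g"
proof -
  let ?v = "int g * m"
  let ?diff = "\<lambda>(i, j). (x i - x j) mod ?v"
  have "inj_on ?diff P"
  proof (rule inj_onI)
    fix s t assume st: "s \<in> P" "t \<in> P" "?diff s = ?diff t"
    obtain i j k l where [simp]: "s = (i, j)" "t = (k, l)" by (metis surj_pair)
    show "s = t"
      using st P[of i j] P[of k l] S unfolding sidon_family_def cong_def by auto
  qed
  then have "card P = card (?diff ` P)" by (simp add: card_image)
  also have "\<dots> \<le> card ((\<lambda>k. int k * m + d) ` {..<g})"
  proof (rule card_mono)
    show "?diff ` P \<subseteq> (\<lambda>k. int k * m + d) ` {..<g}"
    proof clarify
      fix i j assume ij: "(i, j) \<in> P"
      define y where "y = (x i - x j) mod ?v"
      have "0 < ?v" using \<open>0 < m\<close> \<open>0 < g\<close> by simp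
      then have y: "0 \<le> y" "y < ?v" by (simp_all add: y_def)
      have "y mod m = d" using P[OF ij] by (simp add: y_def mod_mod_cancel)
      then have "y = (y div m) * m + d" by (metis div_mult_mod_eq)
      moreover have "0 \<le> y div m" using y \<open>0 < m\<close> by (simp add: pos_imp_zdiv_nonneg_iff)
      moreover have "y div m < int g"
      proof -
        have "(y div m) * m \<le> y" by (metis \<open>0 < m\<close> add_increasing2 div_mult_mod_eq order_refl pos_mod_sign)
        then show ?thesis using y \<open>0 < m\<close> by (meson le_less_trans mult_less_cancel_right_pos)
      qed
      ultimately show "(x i - x j) mod ?v \<in> (\<lambda>k. int k * m + d) ` {..<g}"
        unfolding y_def[symmetric] by (intro image_eqI[of _ _ "nat (y div m)"]) auto
    qed
  qed auto
  also have "\<dots> \<le> g" using card_image_le[of "{..<g}"] by fastforce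
  finally show ?thesis .
qed

text \<open>Keep the first index of each residue class. Each discarded \<open>j\<close> in
  \<open>K\<close>, with an earlier partner \<open>f j\<close>, gives two ordered pairs of
  difference 0 modulo \<open>m\<close>. At most \<open>g\<close> such pairs exist, so
  \<open>2 * card K\<close> is at most \<open>g\<close>.\<close>

lemma sidon_family_inj_on_subset:
  assumes "0 < m" "0 < g" "finite I" and S: "sidon_family (int g * m) I x"
  shows "\<exists>J\<subseteq>I. card I \<le> card J + g div 2 \<and> inj_on (\<lambda>i. x i mod m) J"
proof -
  define K where "K = {j \<in> I. \<exists>i\<in>I. i < j \<and> x i mod m = x j mod m}"
  then have "\<forall>j\<in>K. \<exists>i. i \<in> I \<and> i < j \<and> x i mod m = x j mod m" by auto
  then obtain f where f: "\<And>j. j \<in> K \<Longrightarrow> f j \<in> I \<and> f j < j \<and> x (f j) mod m = x j mod m"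
    by metis
  have K: "K \<subseteq> I" by (auto simp: K_def)
  then have "finite K" using \<open>finite I\<close> finite_subset by blast
  let ?P = "(\<lambda>j. (j, f j)) ` K" and ?Q = "(\<lambda>j. (f j, j)) ` K"
  have "card (?P \<union> ?Q) \<le> g"
  proof (rule sidon_family_card_pairs[OF assms(1,2) S])
    fix i j assume "(i, j) \<in> ?P \<union> ?Q"
    then have "i \<in> I \<and> j \<in> I \<and> i \<noteq> j \<and> x i mod m = x j mod m"
      using f K by fastforce
    then show "i \<in> I \<and> j \<in> I \<and> i \<noteq> j \<and> (x i - x j) mod m = 0"
      by (metis mod_eq_dvd_iff dvd_eq_mod_eq_0)
  qed
  \<comment> \<open>Since \<open>f j < j\<close>, pairs in \<open>?P\<close> decrease and pairs in
    \<open>?Q\<close> increase.\<close>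
  moreover have "?P \<inter> ?Q = {}" using f by (smt (verit) disjoint_iff image_iff less_asym prod.inject)
  moreover have "card ?P = card K" "card ?Q = card K" by (simp_all add: card_image inj_on_def)
  ultimately have "2 * card K \<le> g" using \<open>finite K\<close> by (simp add: card_Un_disjoint)
  moreover have "card I = card (I - K) + card K"
    using K \<open>finite I\<close> \<open>finite K\<close> by (simp add: card_Diff_subset card_mono)
  moreover have "inj_on (\<lambda>i. x i mod m) (I - K)"
    by (rule linorder_inj_onI') (auto simp: K_def)
  ultimately show ?thesis by (intro exI[of _ "I - K"]) auto
qed

text \<open>Any \<open>n\<close> of the indices with distinct residues will do: a difference
  \<open>d\<close> that is nonzero modulo \<open>m\<close> comes from distinct indices, so its
  representations are among the at most \<open>g\<close> counted before.\<close>

lemma modular_golomb_of_sidon_family: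
  assumes "0 < m" "0 < g" "finite I" and S: "sidon_family (int g * m) I x"
    and n: "n + g div 2 \<le> card I"
  shows "\<exists>B. modular_golomb g m B \<and> card B = n"
proof -
  obtain J where J: "J \<subseteq> I" "card I \<le> card J + g div 2" "inj_on (\<lambda>i. x i mod m) J"
    using sidon_family_inj_on_subset[OF assms(1-4)] by auto
  then obtain H where H: "H \<subseteq> J" "card H = n"
    using n by (metis add_le_cancel_right le_trans obtain_subset_with_card_n)
  define y where "y i = x i mod m" for i
  have inj: "inj_on y H" using J(3) H(1) inj_on_subset unfolding y_def by blast
  have "card {(u, w). u \<in> y ` H \<and> w \<in> y ` H \<and> (w - u) mod m = d} \<le> g" if "0 < d" for d
  proof -
    let ?P = "{(i, j). i \<in> H \<and> j \<in> H \<and> (x i - x j) mod m = d}"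
    have "finite H" using H(1) J(1) \<open>finite I\<close> by (metis finite_subset)
    then have fin: "finite ?P" by (intro finite_subset[of ?P "H \<times> H"]) auto
    have "{(u, w). u \<in> y ` H \<and> w \<in> y ` H \<and> (w - u) mod m = d} \<subseteq> (\<lambda>(i, j). (y j, y i)) ` ?P"
      by (auto simp: y_def mod_diff_eq image_iff)
    then have "card {(u, w). u \<in> y ` H \<and> w \<in> y ` H \<and> (w - u) mod m = d} \<le> card ?P"
      by (rule surj_card_le[OF fin])
    also have "\<dots> \<le> g"
      by (rule sidon_family_card_pairs[OF assms(1,2) S, of ?P d]) (use H J that in auto)
    finally show ?thesis .
  qed
  then have "modular_golomb g m (y ` H)"
    using \<open>0 < m\<close> by (auto simp: modular_golomb_def y_def)
  moreover have "card (y ` H) = n" using inj H by (simp add: card_image)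
  ultimately show ?thesis by blast
qed

text \<open>Ruzsa's construction: by the Chinese remainder theorem \<open>x i\<close> encodes the pair
  \<open>(i mod (p - 1), t ^ i mod p)\<close> for a primitive root \<open>t\<close>.\<close>

lemma ruzsa_sidon_family:
  assumes "prime p"
  shows "\<exists>x. sidon_family (int (p * (p - 1))) {..<p - 1} x"
proof -
  have p: "p > 1" using assms prime_gt_1_nat by blast
  obtain t where "residue_primroot p t" using prime_primitive_root_exists[of p] assms p by auto
  then have cop: "coprime p t" and ord: "ord p t = p - 1"
    using assms by (auto simp: residue_primroot_def totient_prime)
  define P where "P i = int t ^ i" for i
  have P_inj: "i = j" if "i < p - 1" "j < p - 1" "[P i = P j] (mod int p)" for i j
  proof -
    have "[t ^ i = t ^ j] (mod p)"
      using that(3) by (simp add: P_def flip: of_nat_power cong_int_iff)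
    then have "[i = j] (mod p - 1)" by (simp only: order_divides_expdiff[OF cop] ord)
    then show ?thesis using that by (simp add: cong_def)
  qed
  \<comment> \<open>As \<open>p\<close> is 1 modulo \<open>p - 1\<close> and \<open>-(p - 1)\<close>
    is 1 modulo \<open>p\<close>, \<open>x i\<close> is congruent to \<open>i\<close> modulo
    \<open>p - 1\<close> and to \<open>P i\<close> modulo \<open>p\<close>.\<close>
  define x where "x i = int p * int i - (int p - 1) * P i" for i
  have "i = k \<and> j = l"
    if lt: "i < p - 1" "j < p - 1" "k < p - 1" "l < p - 1" and "i \<noteq> j"
      and eq: "[x i - x j = x k - x l] (mod int (p * (p - 1)))" for i j k l
  proof -
    have "int (p * (p - 1)) = int p * (int p - 1)" using p by (simp add: of_nat_diff)
    then have dv: "int p * (int p - 1) dvd (x i - x j) - (x k - x l)"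
      using eq by (simp only: cong_iff_dvd_diff)
    have "int p - 1 dvd (x i - x j) - (x k - x l)" using dv by (rule dvd_mult_right)
    moreover have "(x i - x j) - (x k - x l) = (int i + int l - int k - int j)
        + (int p - 1) * ((int i + int l - int k - int j) - (P i + P l - P k - P j))"
      by (simp add: x_def algebra_simps)
    ultimately have "int p - 1 dvd int i + int l - int k - int j"
      by (metis dvd_add_left_iff dvd_triv_left)
    then have "[int (i + l) = int (k + j)] (mod int (p - 1))"
      using p by (simp add: cong_iff_dvd_diff of_nat_diff algebra_simps)
    then have add: "[i + l = k + j] (mod p - 1)" by (simp only: cong_int_iff)
    have "int p dvd (x i - x j) - (x k - x l)" using dv by (rule dvd_mult_left)
    moreover have "(x i - x j) - (x k - x l) = (P i + P l - P k - P j)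
        + int p * ((int i + int l - int k - int j) - (P i + P l - P k - P j))"
      by (simp add: x_def algebra_simps)
    ultimately have sum: "int p dvd P i + P l - P k - P j"
      by (metis dvd_add_left_iff dvd_triv_left)
    \<comment> \<open>The additive relation between exponents becomes a multiplicative one between
      powers of \<open>t\<close>.\<close>
    have "[t ^ (i + l) = t ^ (k + j)] (mod p)"
      using add by (simp add: order_divides_expdiff[OF cop] ord)
    then have "[int (t ^ (i + l)) = int (t ^ (k + j))] (mod int p)"
      by (simp only: cong_int_iff)
    then have prod: "int p dvd P i * P l - P k * P j"
      by (simp add: cong_iff_dvd_diff P_def power_add)
    text \<open>\<open>P i, P l\<close> and \<open>P k, P j\<close> have the same sum and product modulo \<open>p\<close>.\<close>
    have "(P i - P k) * (P i - P j) = P i * (P i + P l - P k - P j) - (P i * P l - P k * P j)"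
      by (simp add: algebra_simps)
    then have "int p dvd (P i - P k) * (P i - P j)"
      using sum prod by (metis dvd_diff dvd_mult)
    then have "int p dvd P i - P k \<or> int p dvd P i - P j"
      using assms by (simp add: prime_dvd_mult_iff)
    \<comment> \<open>The other factor would give \<open>i = j\<close> by
      \<open>P_inj\<close>.\<close>
    then have "i = k" using P_inj lt \<open>i \<noteq> j\<close> by (auto simp: cong_iff_dvd_diff)
    moreover have "j = l"
    proof -
      have "[l = j] (mod p - 1)" using add \<open>i = k\<close> by (simp add: cong_add_lcancel_nat)
      then show ?thesis using lt by (simp add: cong_def)
    qed
    ultimately show ?thesis by blast
  qed
  then have "sidon_family (int (p * (p - 1))) {..<p - 1} x"
    unfolding sidon_family_def by blast
  then show ?thesis by blast
qed

section \<open>The bound on \<open>G g n\<close>\<close>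

theorem theorem8:
  fixes p g n :: nat and a r :: int
  assumes "prime p" "odd p"
    and "g > 0" "n > 0"
    and "g dvd p * (p - 1)"
    and "int n \<le> int p - 1 - \<lfloor>real g / 2\<rfloor>"
    and "int n = a * int g + r" "0 \<le> r" "r < int g"
  shows "real (G g n) \<le> real p * (real p - 1) / real g
    - real_of_int \<lceil>(real p * (real p - 1) / real g
        + real g * real_of_int a * (real_of_int a - 1) / 2
        + real_of_int r * real_of_int a) / real n\<rceil>"
proof -
  have p: "p > 1" using assms(1) prime_gt_1_nat by blast
  obtain m' where m': "p * (p - 1) = g * m'" using assms(5) by auto
  define m where "m = int m'"
  have "m > 0" using m' p by (cases m') (auto simp: m_def)
  have "real p * (real p - 1) = real (p * (p - 1))" using p by (simp add: of_nat_diff)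
  also have "\<dots> = real g * real_of_int m" by (simp only: m' m_def of_nat_mult of_int_of_nat_eq)
  finally have mdiv: "real p * (real p - 1) / real g = real_of_int m"
    using \<open>g > 0\<close> by simp
  have "\<lfloor>real g / 2\<rfloor> = int (g div 2)"
    using floor_divide_of_nat_eq[of g 2] by simp
  then have n: "n + g div 2 \<le> card {..<p - 1}" using assms(6) p by simp
  obtain x where "sidon_family (int g * m) {..<p - 1} x"
    using ruzsa_sidon_family[OF assms(1)] unfolding m' m_def of_nat_mult by blast
  then obtain B where B: "modular_golomb g m B" "card B = n"
    using modular_golomb_of_sidon_family[OF \<open>m > 0\<close> \<open>g > 0\<close> _ _ n] by auto
  \<comment> \<open>With \<open>a\<close> at most -1, \<open>r < g\<close> would make
    \<open>n\<close> negative. This allows passing to \<open>nat a\<close>.\<close>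
  have "a \<ge> 0"
  proof (rule ccontr)
    assume "\<not> ?thesis"
    then have "a * int g \<le> - 1 * int g" by (intro mult_right_mono) auto
    then show False using assms(4,7,9) by linarith
  qed
  have "int n = int (nat a * g + nat r)" using assms(7,8) \<open>a \<ge> 0\<close> by simp
  then have "card B = nat a * g + nat r" using B by linarith
  moreover have "B \<noteq> {}" using B \<open>n > 0\<close> by auto
  ultimately obtain L where L: "int (G g n) \<le> m - L"
    and "2 * m + int g * a * (a - 1) + 2 * r * a \<le> 2 * int n * L"
    using G_le_of_modular_golomb[OF \<open>m > 0\<close> \<open>g > 0\<close> B(1), of "nat a" "nat r"] \<open>a \<ge> 0\<close> assms(8)
    by (simp only: B(2) nat_0_le) blast
  then have "real_of_int (2 * m + int g * a * (a - 1) + 2 * r * a) \<le> real_of_int (2 * int n * L)"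
    by linarith
  then have "(real_of_int m + real g * real_of_int a * (real_of_int a - 1) / 2
      + real_of_int r * real_of_int a) / real n \<le> real_of_int L"
    using \<open>n > 0\<close> by (simp add: field_simps)
  \<comment> \<open>\<open>L\<close> is an integer, so it also bounds the ceiling.\<close>
  then have "\<lceil>(real_of_int m + real g * real_of_int a * (real_of_int a - 1) / 2
      + real_of_int r * real_of_int a) / real n\<rceil> \<le> L"
    by (simp add: ceiling_le_iff)
  with L show ?thesis unfolding mdiv by linarith
qed

end
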